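(* Let $\ell\geq 2$ and $n\ge 2$ be integers. Define $s_0=0$, $s_1=1$ and $s_{i+1}=\ell s_i-s_{i-1}$ for $i\ge 1$, and let ${\boldsymbol s}=(s_1,\ldots,s_n)$. Let \[ L_n^\ell=\left\{\lambda\in\mathbb{Z}^n : 0\leq \frac{\lambda_1}{s_1}\leq \frac{\lambda_2}{s_2}\leq\cdots\leq\frac{\lambda_n}{s_n}\right\}, \] the set of lattice points of the cone $\mathcal{C}_n^\ell=\{\lambda\in\mathbb{R}^n: 0\le\lambda_1/s_1\le\cdots\le\lambda_n/s_n\}$. Then the Hilbert basis of $\mathcal{C}_n^\ell$ is \[ \mathcal{H}_n^\ell=\bigcup_{i=0}^{n}\left\{\lambda\in L_n^\ell : \lambda_{n-1}=s_i,\ \lambda_n=s_{i+1}\right\}. \]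
   Context: For a pointed rational cone $C\subseteq\mathbb{R}^n$, the Hilbert basis of $C$ is the unique minimal subset of $C\cap\mathbb{Z}^n$ generating the semigroup $C\cap\mathbb{Z}^n$ under addition with nonnegative integer coefficients. The terms $s_i$ with $i>n$ are defined by the same recurrence. *)

theory Defs
  imports Complex_Main
begin

text \<open>
  \<open>\<real>\<^sup>n\<close> with coordinates indexed by \<open>1, \<dots>, n\<close>. Coordinates outside this range are
  pinned to 0, so that function equality is vector equality.
\<close>

definition real_vectors :: "nat \<Rightarrow> (nat \<Rightarrow> real) set" where
  "real_vectors n = {x. \<forall>i. i \<notin> {1..n} \<longrightarrow> x i = 0}"

definition int_vectors :: "nat \<Rightarrow> (nat \<Rightarrow> real) set" where
  "int_vectors n = {x \<in> real_vectors n. \<forall>i\<in>{1..n}. x i \<in> \<int>}"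

definition nat_span :: "(nat \<Rightarrow> real) set \<Rightarrow> (nat \<Rightarrow> real) set" where
  "nat_span G = {(\<lambda>i. \<Sum>v\<in>F. real (c v) * v i) | F c. finite F \<and> F \<subseteq> G}"

definition generates_lattice_points :: "nat \<Rightarrow> (nat \<Rightarrow> real) set \<Rightarrow> (nat \<Rightarrow> real) set \<Rightarrow> bool" where
  "generates_lattice_points n C G \<longleftrightarrow>
     G \<subseteq> C \<inter> int_vectors n \<and> nat_span G = C \<inter> int_vectors n"

definition minimal_generating_set :: "nat \<Rightarrow> (nat \<Rightarrow> real) set \<Rightarrow> (nat \<Rightarrow> real) set \<Rightarrow> bool" where
  "minimal_generating_set n C H \<longleftrightarrow>
     generates_lattice_points n C H \<and> (\<forall>G. G \<subset> H \<longrightarrow> \<not> generates_lattice_points n C G)"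

text \<open>
  For a pointed rational cone the minimal generating set exists and is unique. Uniqueness is
  part of the predicate, so it is meaningful without restricting \<open>C\<close> to such cones.
\<close>

definition is_hilbert_basis :: "nat \<Rightarrow> (nat \<Rightarrow> real) set \<Rightarrow> (nat \<Rightarrow> real) set \<Rightarrow> bool" where
  "is_hilbert_basis n C H \<longleftrightarrow>
     minimal_generating_set n C H \<and> (\<forall>H'. minimal_generating_set n C H' \<longrightarrow> H' = H)"

fun s_seq :: "int \<Rightarrow> nat \<Rightarrow> int" where
  "s_seq l 0 = 0"
| "s_seq l (Suc 0) = 1"
| "s_seq l (Suc (Suc i)) = l * s_seq l (Suc i) - s_seq l i"

definition lecture_hall_ineqs :: "int \<Rightarrow> nat \<Rightarrow> (nat \<Rightarrow> real) \<Rightarrow> bool" where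
  "lecture_hall_ineqs l n x \<longleftrightarrow>
     0 \<le> x 1 / of_int (s_seq l 1) \<and>
     (\<forall>i\<in>{1..<n}. x i / of_int (s_seq l i) \<le> x (i + 1) / of_int (s_seq l (i + 1)))"

definition lecture_hall_cone :: "int \<Rightarrow> nat \<Rightarrow> (nat \<Rightarrow> real) set" where
  "lecture_hall_cone l n = {x \<in> real_vectors n. lecture_hall_ineqs l n x}"

definition lecture_hall_points :: "int \<Rightarrow> nat \<Rightarrow> (nat \<Rightarrow> real) set" where
  "lecture_hall_points l n = {x \<in> int_vectors n. lecture_hall_ineqs l n x}"

end

theory Submission
  imports Defs
begin

text \<open>
  The last two coordinates of a lattice point lie in the plane cone spanned by \<open>(0, 1)\<close> and
  \<open>(s\<^bsub>n-1\<^esub>, s\<^bsub>n\<^esub>)\<close>. Consecutive vectors \<open>(s\<^bsub>i\<^esub>, s\<^bsub>i+1\<^esub>)\<close> have determinant 1 and cut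
  this cone into unimodular pieces, so they form its Hilbert basis; as only the zero point of the
  full cone has last coordinate 0, points lying over them are irreducible. Conversely, from a
  nonzero point \<open>\<lambda>\<close> one can split off the following point \<open>h\<close>. Take \<open>i < n\<close> maximal
  with \<open>s\<^bsub>i\<^esub> \<le> \<lambda>\<^bsub>n-1\<^esub>\<close>, and let \<open>h\<close> end in
  \<open>\<dots>, s\<^bsub>i-1\<^esub>, s\<^bsub>i\<^esub>, s\<^bsub>i+1\<^esub>\<close>; going down, at the first coordinate where
  \<open>\<lambda>\<close> is smaller than the required term, let \<open>h\<close> agree with \<open>\<lambda>\<close> from there on.
  The maximality of \<open>i\<close> is inherited at each step, which makes \<open>\<lambda> - h\<close> stay in the cone.
\<close>

section \<open>Hilbert bases from irreducible generators\<close>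

lemma zero_in_nat_span: "(\<lambda>_. 0) \<in> nat_span G"
  unfolding nat_span_def by (force intro!: exI[of _ "{}"])

lemma nat_span_mono: "G \<subseteq> H \<Longrightarrow> nat_span G \<subseteq> nat_span H"
  unfolding nat_span_def by blast

lemma nat_span_add:
  assumes "v \<in> G" and "w \<in> nat_span G"
  shows "(\<lambda>i. v i + w i) \<in> nat_span G"
proof -
  obtain F c where F: "finite F" "F \<subseteq> G" and w: "w = (\<lambda>i. \<Sum>u\<in>F. real (c u) * u i)"
    using assms(2) unfolding nat_span_def by auto
  define d where "d u = (if u \<in> F then c u else 0) + (if u = v then 1 else 0)" for u
  have sum: "(\<Sum>u\<in>insert v F. real (d u) * u i) = v i + w i" for i
  proof -
    have "(\<Sum>u\<in>insert v F. real (d u) * u i)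
        = (\<Sum>u\<in>insert v F. if u \<in> F then real (c u) * u i else 0)
          + (\<Sum>u\<in>insert v F. if u = v then u i else 0)"
      unfolding sum.distrib[symmetric] by (rule sum.cong) (auto simp: d_def algebra_simps)
    also have "(\<Sum>u\<in>insert v F. if u = v then u i else 0) = v i"
      using F by simp
    also have "(\<Sum>u\<in>insert v F. if u \<in> F then real (c u) * u i else 0)
        = (\<Sum>u\<in>F. real (c u) * u i)"
      using F by (intro sum.mono_neutral_cong_right) auto
    finally show ?thesis by (simp add: w)
  qed
  have "finite (insert v F)" "insert v F \<subseteq> G" using F assms(1) by auto
  then show ?thesis unfolding nat_span_def sum[symmetric] by blast
qed

lemma nat_span_subset:
  assumes "G \<subseteq> S" and zero: "(\<lambda>_. 0) \<in> S"
    and add: "\<And>v w. v \<in> S \<Longrightarrow> w \<in> S \<Longrightarrow> (\<lambda>i. v i + w i) \<in> S"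
  shows "nat_span G \<subseteq> S"
proof
  fix w assume "w \<in> nat_span G"
  then obtain F c where F: "finite F" "F \<subseteq> G" and w: "w = (\<lambda>i. \<Sum>u\<in>F. real (c u) * u i)"
    unfolding nat_span_def by auto
  have multiple: "(\<lambda>i. real m * u i) \<in> S" if "u \<in> S" for m :: nat and u
  proof (induction m)
    case 0
    show ?case using zero by simp
  next
    case (Suc m)
    show ?case using add[OF that Suc] by (simp add: algebra_simps)
  qed
  have "(\<lambda>i. \<Sum>u\<in>F. real (c u) * u i) \<in> S"
    using F
  proof (induction F rule: finite_induct)
    case empty
    show ?case using zero by simp
  next
    case (insert u F)
    then show ?case using add[OF multiple, of u] assms(1) by auto
  qed
  then show "w \<in> S" by (simp add: w)
qed

text \<open>Lowering a positive coefficient by one peels off a single generator and keeps the rest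
  in the span. A nonzero generator with positive coefficient exists, since otherwise every term of
  the sum vanishes.\<close>

lemma nat_span_nonzeroE:
  assumes "h \<in> nat_span G" and "h \<noteq> (\<lambda>_. 0)"
  obtains v w where "v \<in> G" "v \<noteq> (\<lambda>_. 0)" "w \<in> nat_span G" "h = (\<lambda>i. v i + w i)"
proof -
  obtain F c where F: "finite F" "F \<subseteq> G" and h: "h = (\<lambda>i. \<Sum>u\<in>F. real (c u) * u i)"
    using assms(1) unfolding nat_span_def by auto
  have "\<exists>v\<in>F. c v > 0 \<and> v \<noteq> (\<lambda>_. 0)"
  proof (rule ccontr)
    assume "\<not> ?thesis"
    then have "real (c u) * u i = 0" if "u \<in> F" for u i
      using that by (metis gr0I mult_eq_0_iff of_nat_0)
    then have "h = (\<lambda>_. 0)" unfolding h by (intro ext sum.neutral) blast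
    with assms(2) show False by simp
  qed
  then obtain v where v: "v \<in> F" "c v > 0" "v \<noteq> (\<lambda>_. 0)" by blast
  define w where "w i = (\<Sum>u\<in>F. real ((c(v := c v - 1)) u) * u i)" for i
  have "w \<in> nat_span G"
    using F unfolding nat_span_def w_def by blast
  moreover have "h i = v i + w i" for i
    using F v(1,2) by (simp add: h w_def sum.remove[OF _ v(1)] of_nat_diff algebra_simps)
  ultimately show thesis using that v F by blast
qed

text \<open>Write an irreducible \<open>h\<close> over any generating set \<open>G\<close> and peel
  off a nonzero generator \<open>v\<close>: the remainder must be 0, so \<open>h = v\<close> lies in
  \<open>G\<close>. Thus \<open>H\<close> is contained in every generating set, which gives
  minimality and uniqueness at once.\<close>

lemma is_hilbert_basisI:
  assumes gen: "generates_lattice_points n C H"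
    and nonzero: "\<And>h. h \<in> H \<Longrightarrow> h \<noteq> (\<lambda>_. 0)"
    and irreducible: "\<And>h v w. h \<in> H \<Longrightarrow> v \<in> C \<inter> int_vectors n \<Longrightarrow> w \<in> C \<inter> int_vectors n
      \<Longrightarrow> h = (\<lambda>i. v i + w i) \<Longrightarrow> v = (\<lambda>_. 0) \<or> w = (\<lambda>_. 0)"
  shows "is_hilbert_basis n C H"
proof -
  have least: "H \<subseteq> G" if G: "generates_lattice_points n C G" for G
  proof
    fix h assume h: "h \<in> H"
    have "h \<in> nat_span G"
      using G gen h unfolding generates_lattice_points_def by auto
    then obtain v w where vw: "v \<in> G" "v \<noteq> (\<lambda>_. 0)" "w \<in> nat_span G" "h = (\<lambda>i. v i + w i)"
      using nonzero[OF h] by (rule nat_span_nonzeroE)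
    moreover have "v \<in> C \<inter> int_vectors n" "w \<in> C \<inter> int_vectors n"
      using G vw unfolding generates_lattice_points_def by auto
    ultimately have "w = (\<lambda>_. 0)" using irreducible[OF h, of v w] by simp
    then show "h \<in> G" using vw by simp
  qed
  have "\<not> generates_lattice_points n C G" if "G \<subset> H" for G
    using least[of G] that by auto
  then have minimal: "minimal_generating_set n C H"
    unfolding minimal_generating_set_def using gen by simp
  have unique: "H' = H" if "minimal_generating_set n C H'" for H'
  proof (rule ccontr)
    assume "H' \<noteq> H"
    moreover have "H \<subseteq> H'"
      using that least[of H'] unfolding minimal_generating_set_def by simp
    ultimately show False using that gen unfolding minimal_generating_set_def by auto
  qed
  show ?thesis
    unfolding is_hilbert_basis_def by (intro conjI allI impI minimal unique)
qed

section \<open>The plane cone of the last two coordinates\<close>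

text \<open>The increments never decrease, because \<open>l\<close> may be replaced by 2 in front of
  a nonnegative term; for this reason nonnegativity is carried along in the induction.\<close>

lemma s_seq_strict_growth:
  assumes "l \<ge> 2"
  shows "s_seq l i \<ge> 0 \<and> s_seq l i < s_seq l (Suc i)"
proof (induction i)
  case (Suc i)
  then have nonneg: "0 \<le> s_seq l (Suc i)" by linarith
  then have "2 * s_seq l (Suc i) \<le> l * s_seq l (Suc i)"
    by (rule mult_right_mono[OF assms])
  moreover have "s_seq l (Suc (Suc i)) = l * s_seq l (Suc i) - s_seq l i" by (rule s_seq.simps(3))
  ultimately show ?case using Suc nonneg by linarith
qed simp

lemma s_seq_strict_mono: "l \<ge> 2 \<Longrightarrow> i < j \<Longrightarrow> s_seq l i < s_seq l j"
  by (rule lift_Suc_mono_less[of "s_seq l"]) (auto simp: s_seq_strict_growth simp del: s_seq.simps)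

lemma s_seq_nonneg: "l \<ge> 2 \<Longrightarrow> s_seq l i \<ge> 0"
  using s_seq_strict_growth by blast

lemma s_seq_pos: "l \<ge> 2 \<Longrightarrow> i \<ge> 1 \<Longrightarrow> s_seq l i > 0"
  using s_seq_strict_mono[of l 0 i] by simp

text \<open>The recurrence is the plane map (x, y) -> (y, l y - x) of determinant 1, so advancing
  both vectors preserves their determinant; at \<open>p = 0\<close> its value is s_m.\<close>

lemma s_seq_det_add:
  "s_seq l (Suc p) * s_seq l (p + m) - s_seq l p * s_seq l (Suc (p + m)) = s_seq l m"
proof (induction p)
  case (Suc p)
  then show ?case by (simp add: algebra_simps)
qed simp

lemma s_seq_det:
  "p \<le> q \<Longrightarrow> s_seq l (Suc p) * s_seq l q - s_seq l p * s_seq l (Suc q) = s_seq l (q - p)"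
  using s_seq_det_add[of l p "q - p"] by simp

lemma s_seq_ratio_mono:
  assumes "l \<ge> 2" "p \<le> q"
  shows "s_seq l p * s_seq l (Suc q) \<le> s_seq l (Suc p) * s_seq l q"
  using s_seq_det[OF assms(2), of l] s_seq_nonneg[OF assms(1), of "q - p"] by linarith

section \<open>Splitting plane lattice points along consecutive basis vectors\<close>

text \<open>Cramer's rule for the unimodular pair (s_i, s_(i+1)), (s_(i+1), s_(i+2)), with
  coordinates \<open>b\<close> and \<open>a\<close> respectively. The form d(x, y) = y s_k - x
  s_(k+1), nonnegative exactly on the required side of the cone boundary, takes the values s_(k-i)
  and s_(k-i-1) on this pair.\<close>

lemma unimodular_coordinates:
  fixes x y :: int
  assumes "i < k"
  obtains a b where
    "a = x * s_seq l (Suc i) - y * s_seq l i"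
    "x = a * s_seq l (Suc i) + b * s_seq l i"
    "y = a * s_seq l (Suc (Suc i)) + b * s_seq l (Suc i)"
    "y * s_seq l k - x * s_seq l (Suc k) = a * s_seq l (k - Suc i) + b * s_seq l (k - i)"
proof -
  define a where "a = x * s_seq l (Suc i) - y * s_seq l i"
  define b where "b = y * s_seq l (Suc i) - x * s_seq l (Suc (Suc i))"
  have det: "s_seq l (Suc i) * s_seq l (Suc i) - s_seq l i * s_seq l (Suc (Suc i)) = 1"
    using s_seq_det[of i "Suc i" l] by (simp del: s_seq.simps(3))
  have x: "x = a * s_seq l (Suc i) + b * s_seq l i"
    unfolding a_def b_def using det by algebra
  have y: "y = a * s_seq l (Suc (Suc i)) + b * s_seq l (Suc i)"
    unfolding a_def b_def using det by algebra
  have "y * s_seq l k - x * s_seq l (Suc k)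
      = a * (s_seq l (Suc (Suc i)) * s_seq l k - s_seq l (Suc i) * s_seq l (Suc k))
        + b * (s_seq l (Suc i) * s_seq l k - s_seq l i * s_seq l (Suc k))"
    unfolding x y by (simp only: algebra_simps)
  also have "\<dots> = a * s_seq l (k - Suc i) + b * s_seq l (k - i)"
    using s_seq_det[of "Suc i" k l] s_seq_det[of i k l] assms by (simp del: s_seq.simps)
  finally have "y * s_seq l k - x * s_seq l (Suc k)
      = a * s_seq l (k - Suc i) + b * s_seq l (k - i)" .
  with x y that[OF a_def] show thesis by blast
qed

text \<open>Subtracting (s_i, s_(i+1)) lowers the form d by s_(k-i), so the claim amounts to d \<ge>
  s_(k-i). For \<open>i = k\<close> the form does not change; otherwise the bounds on
  \<open>x\<close> restrict the coordinates \<open>a\<close>, \<open>b\<close> enough to force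
  this.\<close>

lemma subtract_greatest_basis_vector:
  fixes x y :: int
  assumes l: "l \<ge> 2" and "i \<le> k" and lower: "s_seq l i \<le> x"
    and upper: "x < s_seq l (Suc i) \<or> i = k"
    and "y > 0" and cone: "x * s_seq l (Suc k) \<le> y * s_seq l k"
  shows "(x - s_seq l i) * s_seq l (Suc k) \<le> (y - s_seq l (Suc i)) * s_seq l k"
proof (cases "i = k")
  case True
  then show ?thesis using cone by (simp add: algebra_simps)
next
  case False
  with \<open>i \<le> k\<close> have "i < k" by simp
  from False upper have upper: "x < s_seq l (Suc i)" by simp
  obtain a b where x: "x = a * s_seq l (Suc i) + b * s_seq l i"
    and y: "y = a * s_seq l (Suc (Suc i)) + b * s_seq l (Suc i)"
    and d: "y * s_seq l k - x * s_seq l (Suc k) = a * s_seq l (k - Suc i) + b * s_seq l (k - i)"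
    by (rule unimodular_coordinates[OF \<open>i < k\<close>, of x l y])
  define p q u v where "p = s_seq l i" and "q = s_seq l (Suc i)"
    and "u = s_seq l (k - Suc i)" and "v = s_seq l (k - i)"
  have pq: "0 \<le> p" "p < q" unfolding p_def q_def using s_seq_strict_growth[OF l] by auto
  have uv: "0 \<le> u" "u < v"
    unfolding u_def v_def using s_seq_strict_mono[OF l] s_seq_nonneg[OF l] \<open>i < k\<close> by auto
  have d_nonneg: "a * u + b * v \<ge> 0" using d cone unfolding u_def v_def by simp
  have range: "p \<le> a * q + b * p" "a * q + b * p < q"
    using x lower upper unfolding p_def q_def by auto
  have "a * u + b * v \<ge> v"
  proof (rule ccontr)
    assume less: "\<not> a * u + b * v \<ge> v"
    consider "b \<ge> 1" "a \<ge> 0" | "b \<ge> 1" "a < 0" | "b = 0" | "b < 0" by linarith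
    then show False
    proof cases
      case 1
      then have "a * u \<ge> 0" "b * v \<ge> 1 * v" using uv by (auto intro!: mult_right_mono)
      with less show False by simp
    next
      \<comment> \<open>The lower bound on \<open>x\<close> limits how negative \<open>a\<close> can
        be: -a \<le> b - 1. Cancelling \<open>p\<close> requires \<open>p > 0\<close>, which holds
        because \<open>p = 0\<close> would make \<open>a * q\<close> nonnegative.\<close>
      case 2
      have "(- a) * p \<le> (- a) * q" "(- a) * q \<le> (b - 1) * p"
        using 2 pq range by (auto simp: algebra_simps)
      moreover have "p > 0"
      proof (rule ccontr)
        assume "\<not> p > 0"
        then have "p = 0" using pq by simp
        with range 2 pq show False by (simp add: zero_le_mult_iff)
      qed
      ultimately have "- a \<le> b - 1" by (meson mult_right_le_imp_le order_trans)
      then have "(- a) * v \<le> (b - 1) * v" using uv by (intro mult_right_mono) auto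
      moreover have "(- a) * u \<le> (- a) * v" using 2 uv by (intro mult_left_mono) auto
      ultimately show False using less by (simp add: algebra_simps)
    next
      \<comment> \<open>Both bounds on \<open>x\<close> leave only \<open>a = 0\<close>, hence
        \<open>y = 0\<close>.\<close>
      case 3
      with range have "0 \<le> a * q" "a * q < 1 * q" using pq by auto
      then have "0 \<le> a" "a < 1"
        using pq mult_less_cancel_right_pos[of q a 1] by (simp_all add: zero_le_mult_iff)
      then have "a = 0" by simp
      with 3 y \<open>y > 0\<close> show False by simp
    next
      \<comment> \<open>Here d \<ge> 0 forces a > -b, and then x = a q + b p reaches
        \<open>q\<close>, against the upper bound.\<close>
      case 4
      have "a > - b"
      proof (rule ccontr)
        assume "\<not> a > - b"
        then have "a * u \<le> (- b) * u" using uv by (intro mult_right_mono) auto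
        moreover have "(- b) * u < (- b) * v" using 4 uv by (intro mult_strict_left_mono) auto
        ultimately show False using d_nonneg by simp
      qed
      then have "(1 - b) * q \<le> a * q" using pq by (intro mult_right_mono) auto
      moreover have "(- b) * p \<le> (- b) * q" using 4 pq by (intro mult_left_mono) auto
      ultimately show False using range by (simp add: algebra_simps)
    qed
  qed
  then show ?thesis
    using d s_seq_det[OF \<open>i \<le> k\<close>, of l] unfolding u_def v_def by (simp add: algebra_simps)
qed

text \<open>If x \<ge> s_(i+1), integrality of \<open>y\<close> gives y \<le> s_(i+2) - 1, so d(x,
  y) is at most s_(k-i-1) - s_k < 0, which leaves the cone. This passes the maximality of the index
  down to the preceding coordinate.\<close>

lemma upper_bound_inherited:
  fixes x y :: int
  assumes l: "l \<ge> 2" and "i < k" and y: "y < s_seq l (Suc (Suc i))"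
    and cone: "x * s_seq l (Suc k) \<le> y * s_seq l k"
  shows "x < s_seq l (Suc i)"
proof (rule ccontr)
  assume "\<not> x < s_seq l (Suc i)"
  then have "s_seq l (Suc i) * s_seq l (Suc k) \<le> x * s_seq l (Suc k)"
    using s_seq_nonneg[OF l] by (intro mult_right_mono) auto
  also note cone
  also have "y * s_seq l k \<le> (s_seq l (Suc (Suc i)) - 1) * s_seq l k"
    using y s_seq_nonneg[OF l] by (intro mult_right_mono) auto
  finally have "s_seq l k \<le> s_seq l (k - Suc i)"
    using s_seq_det[of "Suc i" k l] \<open>i < k\<close> by (simp add: algebra_simps del: s_seq.simps(3))
  then show False
    using s_seq_strict_mono[OF l, of "k - Suc i" k] \<open>i < k\<close> by simp
qed

text \<open>The claim says that \<open>a\<close>, the coordinate of (x', y') along (s_(i+1),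
  s_(i+2)), is not positive. If a > 0, then x' \<le> s_i forces b \<le> -a, and d \<le> a (u - v) <
  0 contradicts the cone condition.\<close>

lemma basis_vector_summand:
  fixes x y x' y' :: int
  assumes l: "l \<ge> 2" and "i \<le> k"
    and sum: "x + x' = s_seq l i" "y + y' = s_seq l (Suc i)"
    and "0 \<le> x" and cone: "x' * s_seq l (Suc k) \<le> y' * s_seq l k"
  shows "x' * s_seq l (Suc i) \<le> y' * s_seq l i"
proof (cases "i = k")
  case True
  then show ?thesis using cone by simp
next
  case False
  with \<open>i \<le> k\<close> have "i < k" by simp
  obtain a b where a: "a = x' * s_seq l (Suc i) - y' * s_seq l i"
    and x': "x' = a * s_seq l (Suc i) + b * s_seq l i"
    and d: "y' * s_seq l k - x' * s_seq l (Suc k) = a * s_seq l (k - Suc i) + b * s_seq l (k - i)"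
    by (rule unimodular_coordinates[OF \<open>i < k\<close>, of x' l y'])
  define p q u v where "p = s_seq l i" and "q = s_seq l (Suc i)"
    and "u = s_seq l (k - Suc i)" and "v = s_seq l (k - i)"
  have pq: "0 \<le> p" "p < q" unfolding p_def q_def using s_seq_strict_growth[OF l] by auto
  have uv: "0 \<le> u" "u < v"
    unfolding u_def v_def using s_seq_strict_mono[OF l] s_seq_nonneg[OF l] \<open>i < k\<close> by auto
  have "a \<le> 0"
  proof (rule ccontr)
    assume "\<not> a \<le> 0"
    then have a_pos: "a > 0" by simp
    have "a * q \<le> (1 - b) * p"
      using x' sum(1) \<open>0 \<le> x\<close> unfolding p_def q_def by (simp add: algebra_simps)
    moreover have "a * p < a * q" using a_pos pq by simp
    ultimately have "a * p < (1 - b) * p" by simp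
    then have "a < 1 - b" using pq(1) by (simp add: mult_less_cancel_right)
    then have "b * v \<le> (- a) * v" using uv by (intro mult_right_mono) auto
    moreover have "a * u < a * v" using a_pos uv by simp
    moreover have "a * u + b * v \<ge> 0" using d cone unfolding u_def v_def by simp
    ultimately show False by simp
  qed
  with a show ?thesis by simp
qed

text \<open>Both summands lie on the same side of the ray through (s_i, s_(i+1)) while their sum
  lies on it, so both lie on the ray. Its lattice points are integer multiples of the primitive
  vector, and a positive multiple already uses up all of s_(i+1).\<close>

lemma basis_vector_irreducible:
  fixes x y x' y' :: int
  assumes l: "l \<ge> 2" and i: "i \<le> k"
    and sum: "x + x' = s_seq l i" "y + y' = s_seq l (Suc i)"
    and pos: "0 \<le> x" "0 < y" "0 \<le> x'" "0 < y'"
    and cone: "x * s_seq l (Suc k) \<le> y * s_seq l k" "x' * s_seq l (Suc k) \<le> y' * s_seq l k"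
  shows False
proof -
  have le: "x * s_seq l (Suc i) \<le> y * s_seq l i" "x' * s_seq l (Suc i) \<le> y' * s_seq l i"
    using basis_vector_summand[OF l i, of x' x y' y] basis_vector_summand[OF l i sum] sum pos cone
    by (simp_all add: add.commute)
  have "(x + x') * s_seq l (Suc i) = (y + y') * s_seq l i"
    unfolding sum by simp
  with le have eq: "x * s_seq l (Suc i) = y * s_seq l i" by (simp add: algebra_simps)
  obtain a b where a: "a = x * s_seq l (Suc i) - y * s_seq l i"
    and y: "y = a * s_seq l (Suc (Suc i)) + b * s_seq l (Suc i)"
    by (rule unimodular_coordinates[OF lessI, of x l i y])
  have y: "y = b * s_seq l (Suc i)" using a y eq by simp
  have q: "s_seq l (Suc i) > 0" using s_seq_pos[OF l] by simp
  with y pos(2) have "b \<ge> 1" by (simp add: zero_less_mult_iff)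
  then have "1 * s_seq l (Suc i) \<le> y" unfolding y using q by (intro mult_right_mono) auto
  with sum(2) pos(4) show False by simp
qed

section \<open>Integer points of the lecture hall cone\<close>

text \<open>The lecture hall inequalities with denominators cleared, so that the arguments run over
  the integers.\<close>

definition lecture_hall_int :: "int \<Rightarrow> nat \<Rightarrow> (nat \<Rightarrow> int) \<Rightarrow> bool" where
  "lecture_hall_int l n f \<longleftrightarrow>
     0 \<le> f 1 \<and> (\<forall>i\<in>{1..<n}. f i * s_seq l (Suc i) \<le> f (Suc i) * s_seq l i)"

lemma lecture_hall_int_Suc:
  "k \<ge> 1 \<Longrightarrow> lecture_hall_int l (Suc k) f \<longleftrightarrow>
     lecture_hall_int l k f \<and> f k * s_seq l (Suc k) \<le> f (Suc k) * s_seq l k"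
  unfolding lecture_hall_int_def by (auto simp: less_Suc_eq)

lemma lecture_hall_int_cong:
  assumes "k \<ge> 1" and "\<And>i. i \<in> {1..k} \<Longrightarrow> f i = g i"
  shows "lecture_hall_int l k f \<longleftrightarrow> lecture_hall_int l k g"
  unfolding lecture_hall_int_def using assms by (auto intro!: arg_cong2[of _ _ _ _ "(\<and>)"])

lemma lecture_hall_int_zero: "lecture_hall_int l n (\<lambda>_. 0)"
  unfolding lecture_hall_int_def by simp

lemma lecture_hall_int_add:
  "lecture_hall_int l n f \<Longrightarrow> lecture_hall_int l n g \<Longrightarrow> lecture_hall_int l n (\<lambda>i. f i + g i)"
  unfolding lecture_hall_int_def by (auto simp: algebra_simps intro: add_mono)

lemma lecture_hall_int_nonneg:
  assumes l: "l \<ge> 2" and "k \<ge> 1" and "lecture_hall_int l k f"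
  shows "f k \<ge> 0"
  using assms(2,3)
proof (induction k rule: nat_induct_at_least)
  case base
  then show ?case by (simp add: lecture_hall_int_def)
next
  case (Suc k)
  then have "0 \<le> f k * s_seq l (Suc k)" using s_seq_nonneg[OF l] by (simp add: lecture_hall_int_Suc)
  also have "\<dots> \<le> f (Suc k) * s_seq l k" using Suc by (simp add: lecture_hall_int_Suc)
  finally show ?case using s_seq_pos[OF l Suc.hyps] by (simp add: zero_le_mult_iff)
qed

text \<open>A zero coordinate bounds the preceding one above by 0, and nonnegativity bounds it
  below; the zeros thus propagate downwards. This is what lets the last coordinate detect nonzero
  points.\<close>

lemma lecture_hall_int_eq_zero:
  assumes l: "l \<ge> 2" and "k \<ge> 1" and "lecture_hall_int l k f" and "f k = 0" and "i \<in> {1..k}"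
  shows "f i = 0"
  using assms(2-5)
proof (induction k arbitrary: i rule: nat_induct_at_least)
  case base
  then have "i = 1" by simp
  with base show ?case by simp
next
  case (Suc k)
  have "f k * s_seq l (Suc k) \<le> 0" and k: "lecture_hall_int l k f"
    using Suc.prems(1,2) Suc.hyps by (simp_all add: lecture_hall_int_Suc del: s_seq.simps)
  then have "f k \<le> 0" using s_seq_pos[OF l, of "Suc k"] by (simp add: mult_le_0_iff)
  with lecture_hall_int_nonneg[OF l Suc.hyps k] have f_k: "f k = 0" by simp
  show ?case
  proof (cases "i = Suc k")
    case True
    then show ?thesis using Suc.prems(2) by simp
  next
    case False
    then show ?thesis using Suc.IH[OF k f_k] Suc.prems(3) by simp
  qed
qed

section \<open>Splitting generators off integer points\<close>

text \<open>Changing coordinate \<open>Suc k\<close> leaves the inequalities among the first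
  \<open>k\<close> intact, so only the top inequality of each part has to be supplied.\<close>

lemma split_off_extend:
  assumes "k \<ge> 1" and "lecture_hall_int l k h" and "lecture_hall_int l k (\<lambda>j. f j - h j)"
    and "h k * s_seq l (Suc k) \<le> t * s_seq l k"
    and "(f k - h k) * s_seq l (Suc k) \<le> (f (Suc k) - t) * s_seq l k"
  shows "lecture_hall_int l (Suc k) (h(Suc k := t))"
    and "lecture_hall_int l (Suc k) (\<lambda>j. f j - (h(Suc k := t)) j)"
proof -
  have "lecture_hall_int l k (h(Suc k := t)) \<longleftrightarrow> lecture_hall_int l k h"
    by (rule lecture_hall_int_cong) (use assms(1) in auto)
  moreover have "lecture_hall_int l k (\<lambda>j. f j - (h(Suc k := t)) j)
      \<longleftrightarrow> lecture_hall_int l k (\<lambda>j. f j - h j)"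
    by (rule lecture_hall_int_cong) (use assms(1) in auto)
  ultimately show "lecture_hall_int l (Suc k) (h(Suc k := t))"
    and "lecture_hall_int l (Suc k) (\<lambda>j. f j - (h(Suc k := t)) j)"
    using assms by (simp_all add: lecture_hall_int_Suc)
qed

text \<open>The last two hypotheses make \<open>i\<close> the greatest admissible index; the
  alternative \<open>i = k\<close> covers indices capped by the dimension. The induction lowers
  \<open>k\<close> and \<open>i\<close> together.\<close>

lemma split_off:
  assumes l: "l \<ge> 2" and "k \<ge> 1" and "lecture_hall_int l k f"
    and "i \<le> k" and "s_seq l i \<le> f k" and "f k < s_seq l (Suc i) \<or> i = k"
  shows "\<exists>h. h k = s_seq l i \<and> lecture_hall_int l k h \<and> lecture_hall_int l k (\<lambda>j. f j - h j)"
  using assms(2-6)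
proof (induction k arbitrary: i rule: nat_induct_at_least)
  case base
  then show ?case
    using s_seq_nonneg[OF l, of i]
    by (intro exI[of _ "\<lambda>_. s_seq l i"]) (simp add: lecture_hall_int_def)
next
  case (Suc k)
  have f: "lecture_hall_int l k f" and cone: "f k * s_seq l (Suc k) \<le> f (Suc k) * s_seq l k"
    using Suc by (simp_all add: lecture_hall_int_Suc)
  show ?case
  proof (cases i)
    case 0
    then show ?thesis
      using Suc.prems by (intro exI[of _ "\<lambda>_. 0"]) (simp add: lecture_hall_int_zero)
  next
    case (Suc p)
    have "p \<le> k" using Suc Suc.prems by simp
    note ratio = s_seq_ratio_mono[OF l \<open>p \<le> k\<close>]
    show ?thesis
    proof (cases "s_seq l p \<le> f k")
      case True
      \<comment> \<open>An index at the cap \<open>i = Suc k\<close> becomes \<open>p = k\<close>;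
        below the cap the strict bound is inherited.\<close>
      have upper: "f k < s_seq l (Suc p) \<or> p = k"
        using upper_bound_inherited[OF l _ _ cone, of p] Suc.prems Suc \<open>p \<le> k\<close> by fastforce
      then obtain h where h: "h k = s_seq l p" "lecture_hall_int l k h"
          "lecture_hall_int l k (\<lambda>j. f j - h j)"
        using Suc.IH[OF f \<open>p \<le> k\<close> True] by blast
      have "f (Suc k) > 0" using Suc Suc.prems s_seq_pos[OF l, of i] by simp
      then have "(f k - h k) * s_seq l (Suc k) \<le> (f (Suc k) - s_seq l i) * s_seq l k"
        using subtract_greatest_basis_vector[OF l \<open>p \<le> k\<close> True upper _ cone] h Suc by simp
      then show ?thesis
        using split_off_extend[OF Suc.hyps h(2,3), of "s_seq l i"] h(1) ratio Suc
        by (intro exI[of _ "h(Suc k := s_seq l i)"]) (simp add: fun_upd_def)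
    next
      \<comment> \<open>Here \<open>h\<close> copies \<open>f\<close> on the first \<open>k\<close>
        coordinates, so the difference vanishes there. Its top inequality then reads 0 \<le>
        (f_(k+1) - s_i) s_k, and that of \<open>h\<close> follows from f_k < s_p and the ratio
        bound.\<close>
      case False
      then have "f k * s_seq l (Suc k) \<le> s_seq l p * s_seq l (Suc k)"
        using s_seq_nonneg[OF l] by (intro mult_right_mono) auto
      also note ratio
      finally have "f k * s_seq l (Suc k) \<le> s_seq l i * s_seq l k" using Suc by simp
      moreover have "0 \<le> (f (Suc k) - s_seq l i) * s_seq l k"
        using Suc.prems s_seq_nonneg[OF l] by simp
      ultimately show ?thesis
        using split_off_extend[OF Suc.hyps f, of f "s_seq l i"]
        by (intro exI[of _ "f(Suc k := s_seq l i)"]) (simp add: lecture_hall_int_zero fun_upd_def)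
    qed
  qed
qed

lemma split_off_generator:
  assumes l: "l \<ge> 2" and "k \<ge> 1" and "lecture_hall_int l (Suc k) f" and "f (Suc k) > 0"
  obtains h i where "i \<le> k" "h k = s_seq l i" "h (Suc k) = s_seq l (Suc i)"
    "lecture_hall_int l (Suc k) h" "lecture_hall_int l (Suc k) (\<lambda>j. f j - h j)"
proof -
  have f: "lecture_hall_int l k f" and cone: "f k * s_seq l (Suc k) \<le> f (Suc k) * s_seq l k"
    using assms by (simp_all add: lecture_hall_int_Suc)
  \<comment> \<open>The maximum exists: index 0 qualifies because \<open>f k\<close> is nonnegative,
    and \<open>k\<close> bounds the candidates.\<close>
  define i where "i = (GREATEST i. i \<le> k \<and> s_seq l i \<le> f k)"
  have "0 \<le> k \<and> s_seq l 0 \<le> f k"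
    using lecture_hall_int_nonneg[OF l \<open>k \<ge> 1\<close> f] by simp
  then have i: "i \<le> k" "s_seq l i \<le> f k"
    unfolding i_def using GreatestI_nat[of "\<lambda>i. i \<le> k \<and> s_seq l i \<le> f k" 0 k] by auto
  have upper: "f k < s_seq l (Suc i) \<or> i = k"
  proof (rule ccontr)
    assume "\<not> ?thesis"
    with i have "Suc i \<le> i"
      using Greatest_le_nat[of "\<lambda>i. i \<le> k \<and> s_seq l i \<le> f k" "Suc i" k] unfolding i_def[symmetric]
      by simp
    then show False by simp
  qed
  obtain h where h: "h k = s_seq l i" "lecture_hall_int l k h"
      "lecture_hall_int l k (\<lambda>j. f j - h j)"
    using split_off[OF l \<open>k \<ge> 1\<close> f i upper] by blast
  have "(f k - h k) * s_seq l (Suc k) \<le> (f (Suc k) - s_seq l (Suc i)) * s_seq l k"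
    using subtract_greatest_basis_vector[OF l i upper _ cone] assms(4) h(1) by simp
  moreover have "h k * s_seq l (Suc k) \<le> s_seq l (Suc i) * s_seq l k"
    using s_seq_ratio_mono[OF l i(1)] h(1) by simp
  ultimately show thesis
    using split_off_extend[OF \<open>k \<ge> 1\<close> h(2,3), of "s_seq l (Suc i)"] h(1) i(1)
    by (intro that[of i "h(Suc k := s_seq l (Suc i))"]) auto
qed

section \<open>Transfer between real and integer vectors\<close>

lemma lecture_hall_ineqs_of_int:
  assumes l: "l \<ge> 2"
  shows "lecture_hall_ineqs l n (\<lambda>i. of_int (f i)) \<longleftrightarrow> lecture_hall_int l n f"
proof -
  have "real_of_int (f i) / of_int (s_seq l i) \<le> of_int (f (Suc i)) / of_int (s_seq l (Suc i))
      \<longleftrightarrow> f i * s_seq l (Suc i) \<le> f (Suc i) * s_seq l i" if "i \<ge> 1" for i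
    using s_seq_pos[OF l that] s_seq_pos[OF l, of "Suc i"]
    by (simp add: divide_simps del: s_seq.simps flip: of_int_mult)
  then show ?thesis
    unfolding lecture_hall_ineqs_def lecture_hall_int_def by simp
qed

lemma of_int_in_lecture_hall_points:
  assumes "l \<ge> 2"
  shows "(\<lambda>i. of_int (f i)) \<in> lecture_hall_points l n \<longleftrightarrow>
    (\<forall>i. i \<notin> {1..n} \<longrightarrow> f i = 0) \<and> lecture_hall_int l n f"
  using lecture_hall_ineqs_of_int[OF assms, of n f]
  unfolding lecture_hall_points_def int_vectors_def real_vectors_def by simp

lemma lecture_hall_pointsE:
  assumes "l \<ge> 2" and "x \<in> lecture_hall_points l n"
  obtains f where "x = (\<lambda>i. of_int (f i))" "\<And>i. i \<notin> {1..n} \<Longrightarrow> f i = 0" "lecture_hall_int l n f"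
proof -
  have "x i \<in> \<int>" for i
    using assms(2) unfolding lecture_hall_points_def int_vectors_def real_vectors_def
    by (cases "i \<in> {1..n}") auto
  then have eq: "x = (\<lambda>i. of_int \<lfloor>x i\<rfloor>)" by simp
  have "(\<lambda>i. of_int \<lfloor>x i\<rfloor>) \<in> lecture_hall_points l n"
    using assms(2) by (subst eq[symmetric])
  then show thesis
    using eq that[of "\<lambda>i. \<lfloor>x i\<rfloor>"] of_int_in_lecture_hall_points[OF assms(1), of "\<lambda>i. \<lfloor>x i\<rfloor>"]
    by simp
qed

lemma lecture_hall_points_add:
  assumes l: "l \<ge> 2" and "v \<in> lecture_hall_points l n" "w \<in> lecture_hall_points l n"
  shows "(\<lambda>i. v i + w i) \<in> lecture_hall_points l n"
proof -
  obtain f where f: "v = (\<lambda>i. of_int (f i))" "\<And>i. i \<notin> {1..n} \<Longrightarrow> f i = 0" "lecture_hall_int l n f"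
    using lecture_hall_pointsE[OF l assms(2)] by metis
  obtain g where g: "w = (\<lambda>i. of_int (g i))" "\<And>i. i \<notin> {1..n} \<Longrightarrow> g i = 0" "lecture_hall_int l n g"
    using lecture_hall_pointsE[OF l assms(3)] by metis
  have "(\<lambda>i. of_int (f i + g i)) \<in> lecture_hall_points l n"
    unfolding of_int_in_lecture_hall_points[OF l]
    using f(2) g(2) lecture_hall_int_add[OF f(3) g(3)] by simp
  then show ?thesis by (simp add: f(1) g(1))
qed

section \<open>Generation and irreducibility in the full cone\<close>

text \<open>Strong induction on the last coordinate: each generator split off lowers it by some
  s_(i+1) > 0, and a point with last coordinate 0 is the zero vector.\<close>

lemma lecture_hall_generation:
  assumes l: "l \<ge> 2" and k: "k \<ge> 1"
    and "lecture_hall_int l (Suc k) f" and "\<And>i. i \<notin> {1..Suc k} \<Longrightarrow> f i = 0"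
  shows "(\<lambda>i. of_int (f i)) \<in> nat_span (\<Union>i\<in>{0..k}. {x \<in> lecture_hall_points l (Suc k).
    x k = of_int (s_seq l i) \<and> x (Suc k) = of_int (s_seq l (Suc i))})" (is "_ \<in> nat_span ?H")
  using assms(3,4)
proof (induction "nat (f (Suc k))" arbitrary: f rule: less_induct)
  case less
  show ?case
  proof (cases "f (Suc k) = 0")
    case True
    then have "f i = 0" for i
      using less.prems lecture_hall_int_eq_zero[OF l, of "Suc k" f i] by (cases "i \<in> {1..Suc k}") auto
    then show ?thesis using zero_in_nat_span by simp
  next
    case False
    then have "f (Suc k) > 0"
      using lecture_hall_int_nonneg[OF l _ less.prems(1)] by fastforce
    then obtain g i where g: "i \<le> k" "g k = s_seq l i" "g (Suc k) = s_seq l (Suc i)"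
      "lecture_hall_int l (Suc k) g" "lecture_hall_int l (Suc k) (\<lambda>j. f j - g j)"
      using split_off_generator[OF l k less.prems(1)] by blast
    define h where "h j = (if j \<in> {1..Suc k} then g j else 0)" for j
    have h_outside: "h j = 0" if "j \<notin> {1..Suc k}" for j
      using that unfolding h_def by (rule if_not_P)
    have "lecture_hall_int l (Suc k) h"
      using g(4) lecture_hall_int_cong[of "Suc k" h g l] unfolding h_def by simp
    then have "(\<lambda>j. of_int (h j)) \<in> lecture_hall_points l (Suc k)"
      unfolding of_int_in_lecture_hall_points[OF l] using h_outside by blast
    then have "(\<lambda>j. of_int (h j)) \<in> ?H"
      using g(1-3) k by (intro UN_I[of i]) (auto simp: h_def simp del: s_seq.simps)
    moreover have "(\<lambda>j. of_int (f j - h j)) \<in> nat_span ?H"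
    proof (rule less.hyps)
      show "nat (f (Suc k) - h (Suc k)) < nat (f (Suc k))"
        using \<open>f (Suc k) > 0\<close> g(3) s_seq_pos[OF l, of "Suc i"] by (simp add: h_def del: s_seq.simps)
      show "lecture_hall_int l (Suc k) (\<lambda>j. f j - h j)"
        using g(5) lecture_hall_int_cong[of "Suc k" "\<lambda>j. f j - h j" "\<lambda>j. f j - g j" l]
        unfolding h_def by simp
      show "f i - h i = 0" if "i \<notin> {1..Suc k}" for i
        using less.prems(2)[OF that] that by (auto simp: h_def)
    qed
    ultimately have "(\<lambda>j. real_of_int (h j) + of_int (f j - h j)) \<in> nat_span ?H"
      by (rule nat_span_add)
    then show ?thesis by simp
  qed
qed

text \<open>Nonzero summands have positive last coordinates, so projecting to the last two
  coordinates would give a forbidden decomposition of (s_i, s_(i+1)) in the plane cone.\<close>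

lemma lecture_hall_irreducible:
  assumes l: "l \<ge> 2" and k: "k \<ge> 1" and "i \<le> k"
    and v: "v \<in> lecture_hall_points l (Suc k)" and w: "w \<in> lecture_hall_points l (Suc k)"
    and sum: "v k + w k = of_int (s_seq l i)" "v (Suc k) + w (Suc k) = of_int (s_seq l (Suc i))"
  shows "v = (\<lambda>_. 0) \<or> w = (\<lambda>_. 0)"
proof (rule ccontr)
  assume nonzero: "\<not> ?thesis"
  have pos: "f (Suc k) > 0 \<and> f k \<ge> 0 \<and> f k * s_seq l (Suc k) \<le> f (Suc k) * s_seq l k"
    if f: "\<And>i. i \<notin> {1..Suc k} \<Longrightarrow> f i = 0" "lecture_hall_int l (Suc k) f"
      and "(\<lambda>i. real_of_int (f i)) \<noteq> (\<lambda>_. 0)" for f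
  proof -
    obtain j where "f j \<noteq> 0" using \<open>(\<lambda>i. real_of_int (f i)) \<noteq> (\<lambda>_. 0)\<close> by force
    then have "f (Suc k) \<noteq> 0"
      using lecture_hall_int_eq_zero[OF l _ f(2), of j] f(1)[of j] by fastforce
    then show ?thesis
      using lecture_hall_int_nonneg[OF l _ f(2)] lecture_hall_int_nonneg[OF l k, of f] f(2) k
      by (simp add: lecture_hall_int_Suc)
  qed
  obtain f where f: "v = (\<lambda>i. of_int (f i))" "\<And>i. i \<notin> {1..Suc k} \<Longrightarrow> f i = 0"
      "lecture_hall_int l (Suc k) f"
    using lecture_hall_pointsE[OF l v] by metis
  obtain g where g: "w = (\<lambda>i. of_int (g i))" "\<And>i. i \<notin> {1..Suc k} \<Longrightarrow> g i = 0"
      "lecture_hall_int l (Suc k) g"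
    using lecture_hall_pointsE[OF l w] by metis
  have "f k + g k = s_seq l i" "f (Suc k) + g (Suc k) = s_seq l (Suc i)"
    using sum unfolding f(1) g(1) by (simp_all flip: of_int_add del: s_seq.simps)
  then show False
    using basis_vector_irreducible[OF l \<open>i \<le> k\<close>, of "f k" "g k" "f (Suc k)" "g (Suc k)"]
      pos[OF f(2,3)] pos[OF g(2,3)] f(1) g(1) nonzero by simp
qed

theorem theorem4p1:
  fixes l :: int and n :: nat
  assumes "l \<ge> 2" and "n \<ge> 2"
  shows "is_hilbert_basis n (lecture_hall_cone l n)
           (\<Union>i\<in>{0..n}. {x \<in> lecture_hall_points l n.
              x (n - 1) = of_int (s_seq l i) \<and> x n = of_int (s_seq l (i + 1))})"
    (is "is_hilbert_basis n ?C ?H")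
proof -
  note l = assms(1)
  obtain k where n: "n = Suc k" and k: "k \<ge> 1" using assms(2) by (cases n) auto
  have points: "?C \<inter> int_vectors n = lecture_hall_points l n"
    unfolding lecture_hall_cone_def lecture_hall_points_def int_vectors_def by auto
  \<comment> \<open>Reduces the union to the indices \<open>i \<le> k\<close> for which plane
    irreducibility is available.\<close>
  have H_index: "\<exists>i\<le>k. x k = of_int (s_seq l i) \<and> x n = of_int (s_seq l (Suc i))"
    if "x \<in> ?H" for x
  proof -
    obtain i where i: "i \<le> n" "x k = of_int (s_seq l i)" "x n = of_int (s_seq l (Suc i))"
      and x: "x \<in> lecture_hall_points l n"
      using \<open>x \<in> ?H\<close> n by auto
    \<comment> \<open>The index \<open>i = n\<close> contributes nothing: its slope is too small for the cone.\<close>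
    have "i \<noteq> n"
    proof
      assume "i = n"
      obtain f where f: "x = (\<lambda>i. of_int (f i))" "lecture_hall_int l n f"
        using lecture_hall_pointsE[OF l x] by metis
      have "s_seq l n * s_seq l n \<le> s_seq l (Suc n) * s_seq l k"
        using f i(2,3) k unfolding \<open>i = n\<close> n
        by (simp add: lecture_hall_int_Suc del: s_seq.simps)
      then show False using s_seq_det[of k n l] n by (simp add: algebra_simps del: s_seq.simps(3))
    qed
    with i n have "i \<le> k" by simp
    with i show ?thesis by blast
  qed
  show ?thesis
  proof (rule is_hilbert_basisI)
    have "lecture_hall_points l n \<subseteq> nat_span ?H"
    proof
      fix x assume "x \<in> lecture_hall_points l n"
      then obtain f where f: "x = (\<lambda>i. of_int (f i))" "\<And>i. i \<notin> {1..n} \<Longrightarrow> f i = 0"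
          "lecture_hall_int l n f"
        using lecture_hall_pointsE[OF l] by metis
      then have "x \<in> nat_span (\<Union>i\<in>{0..k}. {x \<in> lecture_hall_points l n.
          x k = of_int (s_seq l i) \<and> x n = of_int (s_seq l (Suc i))})"
        using lecture_hall_generation[OF l k, of f] unfolding n by simp
      moreover have "(\<Union>i\<in>{0..k}. {x \<in> lecture_hall_points l n.
          x k = of_int (s_seq l i) \<and> x n = of_int (s_seq l (Suc i))}) \<subseteq> ?H"
        unfolding n by (intro UN_mono) auto
      ultimately show "x \<in> nat_span ?H" by (rule subsetD[OF nat_span_mono, rotated])
    qed
    moreover have "nat_span ?H \<subseteq> lecture_hall_points l n"
    proof (rule nat_span_subset)
      show "(\<lambda>_. 0) \<in> lecture_hall_points l n"
        using of_int_in_lecture_hall_points[OF l, of "\<lambda>_. 0"] by (simp add: lecture_hall_int_zero)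
    qed (use lecture_hall_points_add[OF l] in auto)
    ultimately show "generates_lattice_points n ?C ?H"
      unfolding generates_lattice_points_def points by blast
  next
    fix h assume "h \<in> ?H"
    then obtain i where "h n = of_int (s_seq l (Suc i))" using H_index by blast
    then show "h \<noteq> (\<lambda>_. 0)" using s_seq_pos[OF l, of "Suc i"] by auto
  next
    fix h v w
    assume "h \<in> ?H" and vw: "v \<in> ?C \<inter> int_vectors n" "w \<in> ?C \<inter> int_vectors n"
      and h: "h = (\<lambda>i. v i + w i)"
    then obtain i where i: "i \<le> k" "h k = of_int (s_seq l i)" "h n = of_int (s_seq l (Suc i))"
      using H_index by blast
    show "v = (\<lambda>_. 0) \<or> w = (\<lambda>_. 0)"
      using vw[unfolded points] i(2,3) unfolding h n by (rule lecture_hall_irreducible[OF l k i(1)])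
  qed
qed

end
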